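(* For every integer $n\ge 6$ and every real $\alpha$ with $0<\alpha\le 17$ and $\alpha<\frac{n-1}{2}$, one has $$F(\eta^{\ast}(\alpha),\alpha,n)<0.966537<\frac{97}{100}<1,$$ where $F$ and $\eta^{\ast}$ are the functions defined in the context.
   Context: Here $\log$ is the natural logarithm. The function $\eta^{\ast}$ on $(0,17]$ is $$\eta^{\ast}(\alpha)=\begin{cases}\dfrac{\alpha}{\alpha+3},&0<\alpha\le 11,\\[2mm] 1-\dfrac{\log\alpha}{\alpha},&11<\alpha\le 17.\end{cases}$$ For real $\eta,\alpha$ and an integer $n$, put $$\beta_{\eta,\alpha,n}(t)=1-2\left(1-\frac{\alpha}{n-1}-\frac{\eta}{2}\right)t+\left(1-\frac{2\alpha}{n-1}\right)t^2,$$ and $$F(\eta,\alpha,n)=\frac{\eta}{2\alpha(1-\eta)}+\frac{\eta}{4\alpha}+\frac{1}{2(n-1)}+\frac{\eta}{4\alpha(n-1)}+\frac{\left(1-\frac{2\alpha}{n-1}\right)^2 n(n-1)(n-2)\,\eta}{4\alpha}\int_0^1 t^3\,\beta_{\eta,\alpha,n}(t)^{(n-4)/2}\,dt.$$ *)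

theory Defs
  imports "HOL-Analysis.Analysis"
begin

text \<open>Only the values on (0, 17] are meaningful.\<close>

definition eta_star :: "real \<Rightarrow> real" where
  "eta_star \<alpha> = (if \<alpha> \<le> 11 then \<alpha> / (\<alpha> + 3) else 1 - ln \<alpha> / \<alpha>)"

definition beta :: "real \<Rightarrow> real \<Rightarrow> int \<Rightarrow> real \<Rightarrow> real" where
  "beta \<eta> \<alpha> n t =
     1 - 2 * (1 - \<alpha> / (real_of_int n - 1) - \<eta> / 2) * t
       + (1 - 2 * \<alpha> / (real_of_int n - 1)) * t\<^sup>2"

text \<open>The exponent (n - 4) / 2 may be a half-integer, hence the real power. For
  0 < \<open>\<eta>\<close> < 1 and 0 < 2 \<open>\<alpha>\<close> < n - 1, as in all uses below, the base is positive on [0, 1],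
  so that \<open>powr\<close> is the usual power there.\<close>

definition F :: "real \<Rightarrow> real \<Rightarrow> int \<Rightarrow> real" where
  "F \<eta> \<alpha> n =
     \<eta> / (2 * \<alpha> * (1 - \<eta>)) + \<eta> / (4 * \<alpha>) + 1 / (2 * (real_of_int n - 1))
     + \<eta> / (4 * \<alpha> * (real_of_int n - 1))
     + (1 - 2 * \<alpha> / (real_of_int n - 1))\<^sup>2
         * real_of_int n * (real_of_int n - 1) * (real_of_int n - 2) * \<eta> / (4 * \<alpha>)
       * integral {0..1} (\<lambda>t. t ^ 3 * beta \<eta> \<alpha> n t powr ((real_of_int n - 4) / 2))"

end

theory Submission
  imports Defs
begin

text \<open>
  Write \<open>m = n - 1\<close>, \<open>k = (n - 4) / 2\<close>, \<open>c = 1 - 2 * \<alpha> / m\<close> and \<open>z = m - 2 * \<alpha> = c * m\<close>. The quadratic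
  under the integral factors as \<open>\<beta>(t) = (1 - t) * (1 - c * t) + t * \<eta>\<close>, a convex combination of
  \<open>1 - c * t\<close> and \<open>\<eta>\<close>. Since \<open>k \<ge> 1\<close>, convexity of the \<open>k\<close>-th power separates the two regions that
  contribute to the integral:
  \<open>\<beta>(t)^k \<le> (1 - t) * (1 - c * t)^k + t * \<eta>^k\<close>.
  The second summand, which carries the mass near \<open>t = 1\<close>, integrates against \<open>t^3\<close> to \<open>\<eta>^k / 5\<close>. In
  the first one the weighted arithmetic-geometric mean inequality merges the two factors into one
  power \<open>(1 - l * t)^(k + 1)\<close> with \<open>l = (1 + k * c) / (k + 1)\<close>, whose integral against \<open>t^3\<close> is elementary
  (\<open>integral_cube_quadratic_powr_le\<close>). The loss in both steps is affordable: numerically, the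
  resulting bound for \<open>F\<close> has a maximum of about 0.85, against the required 0.966537.

  The function \<open>\<eta>*\<close> enters through two estimates only. First, \<open>\<eta>* \<le> \<alpha> / (\<alpha> + 3)\<close> on the whole range,
  which bounds all occurrences outside the power by rational functions. Secondly, \<open>\<eta>*^k\<close> is at most
  the exponential of a rational function of \<open>m\<close> and \<open>\<alpha>\<close>, by \<open>ln (1 + x) \<ge> 2 * x / (2 + x)\<close>; for
  \<open>\<alpha> > 11\<close> the logarithm is first replaced by \<open>12 * \<alpha> / (3 * \<alpha> + 23) \<le> ln \<alpha>\<close>. This gives
  \<open>F \<le> alg_part \<alpha> z + exp_part \<alpha> z (\<eta>*^k)\<close> (\<open>F_eta_star_le\<close>).

  What remains is an inequality in the two real variables \<open>\<alpha>\<close> and \<open>z\<close>. For \<open>z \<ge> 6\<close> the rational part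
  is bounded by its value at the lower left corner of a rectangle (\<open>peak_decreasing\<close>), while the
  exponential part is largest, at fixed \<open>z\<close>, at the right end of the range of \<open>\<alpha>\<close>
  (\<open>exp_part_mono_small\<close> for \<open>\<alpha> \<le> 11\<close>, \<open>exp_part_mono_large\<close> for \<open>\<alpha> \<ge> 11\<close> and large \<open>z\<close>), so that it
  may be evaluated at \<open>\<alpha> = 6\<close>, \<open>11\<close> or \<open>17\<close> and becomes a function
  \<open>z^2 * (z + q) * exp (- p * z)\<close> of one variable. Nine rectangles suffice. For \<open>z < 6\<close> the exponential
  part is small, and cruder estimates do.
\<close>

section \<open>Convexity bound for the integral\<close>

lemma powr_convex_combination_le:
  fixes t x y k :: real
  assumes "0 \<le> t" "t \<le> 1" "0 < x" "0 < y" "1 \<le> k"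
  shows "((1 - t) * x + t * y) powr k \<le> (1 - t) * x powr k + t * y powr k"
  using convex_onD[OF powr_convex[OF assms(5)], of t x y] assms by simp

text \<open>
  Weighted arithmetic-geometric mean with weights \<open>1\<close> and \<open>k\<close>: both logarithms lie below the
  tangent of \<open>ln\<close> at the mean, and the linear terms cancel.
\<close>

lemma powr_amgm:
  fixes x y k :: real
  assumes "0 < x" "0 < y" "0 \<le> k"
  shows "x * y powr k \<le> ((x + k * y) / (k + 1)) powr (k + 1)"
proof -
  define A where "A = (x + k * y) / (k + 1)"
  have A: "0 < A" unfolding A_def using assms by (simp add: add_pos_nonneg)
  have sum: "x + k * y = (k + 1) * A" using assms by (simp add: A_def)
  have lnA: "ln u \<le> ln A + (u / A - 1)" if "0 < u" for u
    using ln_le_minus_one[of "u / A"] that A by (simp add: ln_div)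
  have "ln x + k * ln y \<le> (ln A + (x / A - 1)) + k * (ln A + (y / A - 1))"
    using lnA assms by (intro add_mono mult_left_mono) auto
  also have "\<dots> = (k + 1) * ln A + ((x + k * y) / A - (k + 1))"
    using A by (simp add: field_simps)
  also have "\<dots> = (k + 1) * ln A" using sum A by simp
  finally have "exp (ln x + k * ln y) \<le> exp ((k + 1) * ln A)" by simp
  then show ?thesis
    using assms A by (simp add: powr_def exp_add flip: A_def)
qed

text \<open>
  Repeated integration by parts gives an antiderivative whose terms all have the same sign, so
  its value at \<open>1\<close> may be dropped; the bound is the integral over the interval from \<open>0\<close> to the zero \<open>1 / l\<close>.
\<close>

lemma integral_cube_powr_le:
  fixes l p :: real
  assumes l: "0 < l" "l < 1" and p: "0 < p"
  defines "f \<equiv> \<lambda>t. t ^ 3 * (1 - l * t) powr p"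
  shows "f integrable_on {0..1}"
    and "integral {0..1} f \<le> 6 / (l ^ 4 * ((p + 1) * (p + 2) * (p + 3) * (p + 4)))"
proof -
  define U where "U = (\<lambda>i t. (1 - l * t) powr (p + i))"
  define C1 C2 C3 C4 where
    "C1 = 1 / (l * (p + 1))" and "C2 = C1 / (l * (p + 2))"
    and "C3 = C2 / (l * (p + 3))" and "C4 = C3 / (l * (p + 4))"
  note C_defs = C1_def C2_def C3_def C4_def
  have C: "C1 * (l * (p + 1)) = 1" "C2 * (l * (p + 2)) = C1" "C3 * (l * (p + 3)) = C2"
    "C4 * (l * (p + 4)) = C3"
    using l p by (simp_all add: C_defs)
  have C_pos: "0 < C1" "0 < C2" "0 < C3" "0 < C4"
    using l p by (simp_all add: C_defs)
  define Q where "Q = (\<lambda>t. - (C1 * (t ^ 3 * U 1 t) + 3 * C2 * (t ^ 2 * U 2 t)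
     + 6 * C3 * (t * U 3 t) + 6 * C4 * U 4 t))"
  have "(f has_integral (Q 1 - Q 0)) {0..1}"
  proof (rule fundamental_theorem_of_calculus)
    fix t :: real assume t: "t \<in> {0..1}"
    then have "l * t \<le> l" using l by (simp add: mult_left_le)
    with l have u: "0 < 1 - l * t" by linarith
    have D: "(U i has_real_derivative - ((p + i) * l * U (i - 1) t)) (at t within {0..1})" for i
      unfolding U_def using u by (auto intro!: derivative_eq_intros simp: add_diff_eq)
    have "(Q has_real_derivative
        - (C1 * (3 * t ^ 2 * U 1 t - t ^ 3 * ((p + 1) * l * U 0 t))
           + 3 * C2 * (2 * t * U 2 t - t ^ 2 * ((p + 2) * l * U 1 t))
           + 6 * C3 * (U 3 t - t * ((p + 3) * l * U 2 t))
           - 6 * C4 * ((p + 4) * l * U 3 t))) (at t within {0..1})"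
      unfolding Q_def by (rule derivative_eq_intros D refl | simp add: algebra_simps)+
    also have "- (C1 * (3 * t ^ 2 * U 1 t - t ^ 3 * ((p + 1) * l * U 0 t))
           + 3 * C2 * (2 * t * U 2 t - t ^ 2 * ((p + 2) * l * U 1 t))
           + 6 * C3 * (U 3 t - t * ((p + 3) * l * U 2 t))
           - 6 * C4 * ((p + 4) * l * U 3 t)) = t ^ 3 * U 0 t"
      using C by algebra
    finally have "(Q has_real_derivative t ^ 3 * U 0 t) (at t within {0..1})" .
    then show "(Q has_vector_derivative f t) (at t within {0..1})"
      by (simp add: has_real_derivative_iff_has_vector_derivative f_def U_def)
  qed simp
  moreover have "0 \<le> C1 * U 1 1 + 3 * C2 * U 2 1 + 6 * C3 * U 3 1 + 6 * C4 * U 4 1"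
    using C_pos by (intro add_nonneg_nonneg mult_nonneg_nonneg) (simp_all add: U_def)
  then have "Q 1 \<le> 0" unfolding Q_def by simp
  moreover have "Q 0 = - (6 / (l ^ 4 * ((p + 1) * (p + 2) * (p + 3) * (p + 4))))"
    unfolding Q_def U_def C_defs by (simp add: field_simps power4_eq_xxxx)
  ultimately show "f integrable_on {0..1}"
    "integral {0..1} f \<le> 6 / (l ^ 4 * ((p + 1) * (p + 2) * (p + 3) * (p + 4)))"
    by (auto simp: integral_unique has_integral_integrable)
qed

text \<open>
  The base is the convex combination, with weights \<open>1 - t\<close> and \<open>t\<close>, of \<open>1 - c * t\<close> and \<open>e\<close>.
  Convexity of the power splits it, and \<open>powr_amgm\<close> turns \<open>(1 - t) * (1 - c * t) powr k\<close> into a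
  single power with \<open>l = (1 + k * c) / (k + 1)\<close>; both sides then have the same slope at \<open>t = 0\<close>, where
  this part of the integral concentrates for large \<open>k\<close>.
\<close>

lemma integral_cube_quadratic_powr_le:
  fixes c e k :: real
  assumes c: "0 < c" "c < 1" and e: "0 < e" and k: "1 \<le> k"
  shows "integral {0..1} (\<lambda>t. t ^ 3 * ((1 - t) * (1 - c * t) + e * t) powr k)
    \<le> 6 * (k + 1) ^ 4 / ((1 + k * c) ^ 4 * ((k + 2) * (k + 3) * (k + 4) * (k + 5))) + e powr k / 5"
proof -
  define l where "l = (1 + k * c) / (k + 1)"
  have "k * c < k * 1" using c k by (intro mult_strict_left_mono) auto
  then have l: "0 < l" "l < 1" using c k by (simp_all add: l_def add_pos_pos)
  have ct: "0 < 1 - c * t" if "t \<in> {0..1}" for t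
  proof -
    have "c * t \<le> c" using that c by (simp add: mult_left_le)
    with c show ?thesis by linarith
  qed
  have base: "0 < (1 - t) * (1 - c * t) + e * t" if "t \<in> {0..1}" for t
    using ct[OF that] that e by (cases "t = 0") (auto intro: add_nonneg_pos)
  have pointwise: "t ^ 3 * ((1 - t) * (1 - c * t) + e * t) powr k
      \<le> t ^ 3 * (1 - l * t) powr (k + 1) + e powr k * t ^ 4" if t: "t \<in> {0..1}" for t
  proof -
    have "(1 - t) * (1 - c * t) powr k \<le> (1 - l * t) powr (k + 1)"
    proof (cases "t = 1")
      case False
      have "((1 - t) + k * (1 - c * t)) / (k + 1) = 1 - l * t"
        using k by (simp add: l_def field_simps)
      then show ?thesis using powr_amgm[of "1 - t" "1 - c * t" k] ct[OF t] t False k by simp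
    qed simp
    moreover have "((1 - t) * (1 - c * t) + e * t) powr k
        \<le> (1 - t) * (1 - c * t) powr k + t * e powr k"
      using powr_convex_combination_le[of t "1 - c * t" e k] ct[OF t] t e k by (simp add: mult.commute)
    ultimately have "t ^ 3 * ((1 - t) * (1 - c * t) + e * t) powr k
        \<le> t ^ 3 * ((1 - l * t) powr (k + 1) + t * e powr k)"
      using t by (intro mult_left_mono) auto
    then show ?thesis by (simp add: algebra_simps power4_eq_xxxx power3_eq_cube)
  qed
  have "(\<lambda>t. t ^ 3 * ((1 - t) * (1 - c * t) + e * t) powr k) integrable_on {0..1}"
    using base by (intro integrable_continuous_real continuous_intros) force
  moreover have pw4: "((\<lambda>t. e powr k * t ^ 4) has_integral (e powr k / 5)) {0..1}"
  proof -
    have "((\<lambda>t. e powr k * t ^ 4) has_integral (e powr k * 1 ^ 5 / 5 - e powr k * 0 ^ 5 / 5)) {0..1}"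
      by (rule fundamental_theorem_of_calculus)
        (auto simp flip: has_real_derivative_iff_has_vector_derivative intro!: derivative_eq_intros)
    then show ?thesis by simp
  qed
  moreover have cube: "(\<lambda>t. t ^ 3 * (1 - l * t) powr (k + 1)) integrable_on {0..1}"
    "integral {0..1} (\<lambda>t. t ^ 3 * (1 - l * t) powr (k + 1))
      \<le> 6 / (l ^ 4 * ((k + 2) * (k + 3) * (k + 4) * (k + 5)))"
    using integral_cube_powr_le[OF l, of "k + 1"] k by (simp_all add: add.assoc)
  ultimately have "integral {0..1} (\<lambda>t. t ^ 3 * ((1 - t) * (1 - c * t) + e * t) powr k)
      \<le> integral {0..1} (\<lambda>t. t ^ 3 * (1 - l * t) powr (k + 1) + e powr k * t ^ 4)"
    using k pointwise by (intro integral_le integrable_add has_integral_integrable[OF pw4]) auto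
  also have "\<dots> = integral {0..1} (\<lambda>t. t ^ 3 * (1 - l * t) powr (k + 1)) + e powr k / 5"
    using integral_add[OF cube(1) has_integral_integrable[OF pw4]] integral_unique[OF pw4] k
    by (simp only:)
  also have "\<dots> \<le> 6 / (l ^ 4 * ((k + 2) * (k + 3) * (k + 4) * (k + 5))) + e powr k / 5"
    using cube(2) by simp
  also have "6 / (l ^ 4 * ((k + 2) * (k + 3) * (k + 4) * (k + 5)))
      = 6 * (k + 1) ^ 4 / ((1 + k * c) ^ 4 * ((k + 2) * (k + 3) * (k + 4) * (k + 5)))"
    using k by (simp add: l_def power_divide)
  finally show ?thesis .
qed

text \<open>
  With \<open>z = m - 2 * a\<close> the left side is a rational function whose only delicate factor is
  \<open>2 * m + (m - 3) * z\<close>; comparing it with \<open>z + 2\<close> is sharpest at \<open>z = m\<close>, where a polynomial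
  inequality in \<open>m\<close> alone remains. The factor \<open>m + 7\<close> keeps the bound sharp for small \<open>m\<close>.
\<close>

lemma rational_part_le:
  fixes a m :: real
  assumes "0 \<le> a" "5 \<le> m" "2 * a < m"
  shows "(1 - 2 * a / m)\<^sup>2 * (m + 1) * m * (m - 1) *
      (6 * ((m - 3) / 2 + 1) ^ 4 / ((1 + (m - 3) / 2 * (1 - 2 * a / m)) ^ 4 *
        (((m - 3) / 2 + 2) * ((m - 3) / 2 + 3) * ((m - 3) / 2 + 4) * ((m - 3) / 2 + 5))))
    \<le> 96 * m\<^sup>2 * (m - 2 * a)\<^sup>2 / ((m + 7) * (m - 2 * a + 2) ^ 4)"
proof -
  define z where "z = m - 2 * a"
  define w where "w = 2 * m + (m - 3) * z"
  have z: "0 < z" "z \<le> m" using assms by (auto simp: z_def)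
  have w: "0 < w" unfolding w_def using assms z by (intro add_pos_pos mult_pos_pos) auto
  have "(2 + z) * m * (m - 1) \<le> w * (2 + m)"
  proof -
    have "w * (2 + m) - (2 + z) * m * (m - 1) = 6 * (m - z)" 
      by (simp add: w_def algebra_simps power2_eq_square)
    also have "\<dots> \<ge> 0" using z by simp
    finally show ?thesis by simp
  qed
  then have "((2 + z) * m * (m - 1)) ^ 4 \<le> (w * (2 + m)) ^ 4"
    using assms z w by (intro power_mono) auto
  then have "(2 + z) ^ 4 * m ^ 4 * (m - 1) ^ 4 * (m - 1) \<le> w ^ 4 * (2 + m) ^ 4 * (m - 1)"
    using assms by (intro mult_right_mono) (auto simp: power_mult_distrib)
  also have "\<dots> = w ^ 4 * ((m - 1) * (m + 2) ^ 4)" by (simp add: algebra_simps)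
  also have "\<dots> \<le> w ^ 4 * (m ^ 3 * (m + 3) * (m + 5))"
  proof (intro mult_left_mono)
    have "m ^ 3 * (m + 3) * (m + 5) - (m - 1) * (m + 2) ^ 4 = m ^ 3 * (m - 5) + 4 * m ^ 2 * (m - 5) + 12 * m ^ 2 + 16 * m + 16"
      by (simp add: algebra_simps power2_eq_square power3_eq_cube power4_eq_xxxx)
    also have "\<dots> \<ge> 0" using assms by (intro add_nonneg_nonneg mult_nonneg_nonneg) auto
    finally show "(m - 1) * (m + 2) ^ 4 \<le> m ^ 3 * (m + 3) * (m + 5)" by simp
  qed simp
  finally have key: "(2 + z) ^ 4 * m ^ 4 * (m - 1) ^ 5 \<le> w ^ 4 * m ^ 3 * (m + 3) * (m + 5)"
    by (simp add: numeral_eq_Suc mult.assoc mult.commute mult.left_commute)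
  have c: "1 - 2 * a / m = z / m" using assms by (simp add: z_def field_simps)
  have d: "1 + (m - 3) / 2 * (z / m) = w / (2 * m)" using assms by (simp add: w_def field_simps)
  have k: "(m - 3) / 2 + 1 = (m - 1) / 2" "(m - 3) / 2 + 2 = (m + 1) / 2" "(m - 3) / 2 + 3 = (m + 3) / 2"
    "(m - 3) / 2 + 4 = (m + 5) / 2" "(m - 3) / 2 + 5 = (m + 7) / 2" by (simp_all add: field_simps)
  have "(1 - 2 * a / m)\<^sup>2 * (m + 1) * m * (m - 1) *
      (6 * ((m - 3) / 2 + 1) ^ 4 / ((1 + (m - 3) / 2 * (1 - 2 * a / m)) ^ 4 *
        (((m - 3) / 2 + 2) * ((m - 3) / 2 + 3) * ((m - 3) / 2 + 4) * ((m - 3) / 2 + 5))))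
    = 96 * z\<^sup>2 / (m + 7) * (m ^ 3 * (m - 1) ^ 5 / (w ^ 4 * (m + 3) * (m + 5)))"
    unfolding c d k using assms w
    by (simp add: divide_simps) (simp add: numeral_eq_Suc mult.assoc mult.commute mult.left_commute)
  also have "\<dots> \<le> 96 * z\<^sup>2 / (m + 7) * (m\<^sup>2 / (2 + z) ^ 4)"
  proof (intro mult_left_mono)
    show "m ^ 3 * (m - 1) ^ 5 / (w ^ 4 * (m + 3) * (m + 5)) \<le> m\<^sup>2 / (2 + z) ^ 4"
      using key assms w z
      by (simp add: divide_simps) (simp add: numeral_eq_Suc mult.assoc mult.commute mult.left_commute)
  qed (use assms in auto)
  also have "\<dots> = 96 * m\<^sup>2 * z\<^sup>2 / ((m + 7) * (z + 2) ^ 4)" by (simp add: add.commute mult.commute)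
  finally show ?thesis by (simp add: z_def)
qed

section \<open>Logarithm and exponential estimates\<close>

lemma ln_one_plus_ge:
  fixes x :: real
  assumes "0 \<le> x"
  shows "2 * x / (2 + x) \<le> ln (1 + x)"
proof -
  let ?g = "\<lambda>x. ln (1 + x) - 2 * x / (2 + x)"
  have "?g 0 \<le> ?g x"
  proof (rule DERIV_nonneg_imp_nondecreasing[OF assms])
    fix u :: real assume u: "0 \<le> u" "u \<le> x"
    have "(?g has_real_derivative (1 / (1 + u) - (2 * (2 + u) - 2 * u) / ((2 + u) * (2 + u)))) (at u)"
      using u by (auto intro!: derivative_eq_intros)
    then have "(?g has_real_derivative (1 / (1 + u) - 4 / (2 + u)\<^sup>2)) (at u)"
      by (simp add: power2_eq_square)
    moreover have "4 / (2 + u)\<^sup>2 \<le> 1 / (1 + u)"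
      using u by (simp add: divide_simps) (simp add: algebra_simps power2_eq_square)
    ultimately show "\<exists>y. (?g has_real_derivative y) (at u) \<and> 0 \<le> y"
      by (intro exI[of _ "1 / (1 + u) - 4 / (2 + u)\<^sup>2"]) auto
  qed
  then show ?thesis by simp
qed

lemma exp_1_ge: "2.718 \<le> exp (1 :: real)"
  using e_approx_32 by (simp add: abs_if field_simps split: if_splits)

text \<open>
  Numerical evaluation of \<open>exp\<close>: the integral part of the exponent is handled by \<open>e \<ge> 2.718\<close>,
  the rest by the quadratic Taylor polynomial at an eighth of the argument.
\<close>

lemma exp_minus_le:
  fixes f v :: real
  assumes "0 \<le> f" "1 \<le> v * (2.718 ^ n * (1 + f / 8 + (f / 8)\<^sup>2 / 2) ^ 8)"
  shows "exp (- (real n + f)) \<le> v"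
proof -
  let ?q = "1 + f / 8 + (f / 8)\<^sup>2 / 2"
  have q: "0 < ?q" using assms by (intro add_pos_nonneg) auto
  then have "0 < 2.718 ^ n * ?q ^ 8" by simp
  with assms(2) have v: "0 \<le> v" by (smt (verit) mult_nonneg_nonpos2 mult_neg_pos)
  have "2.718 ^ n * ?q ^ 8 \<le> exp 1 ^ n * exp (f / 8) ^ 8"
    using assms q exp_1_ge by (intro mult_mono power_mono exp_lower_Taylor_quadratic) auto
  also have "\<dots> = exp (real n + f)" by (simp add: exp_add flip: exp_of_nat_mult)
  finally have "v * (2.718 ^ n * ?q ^ 8) \<le> v * exp (real n + f)" using v by (rule mult_left_mono)
  with assms(2) have "1 \<le> v * exp (real n + f)" by linarith
  then show ?thesis by (simp only: exp_minus inverse_eq_divide) (simp add: pos_divide_le_eq)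
qed

lemma ln_11_ge: "33 / 14 \<le> ln (11 :: real)"
proof -
  have "(107 / 112) ^ 8 \<le> exp (- (5 / 112) :: real) ^ 8"
    using exp_ge_add_one_self[of "- (5 / 112)"] by (intro power_mono) auto
  also have "\<dots> = exp (- (5 / 14))" by (simp flip: exp_of_nat_mult)
  finally have "exp (5 / 14) \<le> (1.45 :: real)" by (simp add: exp_minus field_simps)
  moreover have "exp 1 ^ 2 \<le> (272 / 100 :: real) ^ 2" using e_less_272 by (intro power_mono) auto
  ultimately have "exp 1 ^ 2 * exp (5 / 14) \<le> (272 / 100) ^ 2 * (1.45 :: real)" by (intro mult_mono) auto
  also have "exp 1 ^ 2 * exp (5 / 14) = exp (33 / 14 :: real)"
    by (simp flip: exp_add exp_of_nat_mult)
  finally have "exp (33 / 14) \<le> (11 :: real)" by (simp add: power2_eq_square)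
  then show ?thesis by (subst ln_ge_iff) auto
qed

text \<open>
  The difference of the two sides is nondecreasing on the whole positive axis, because the
  numerator of its derivative is the square \<open>(3 * a - 23)^2\<close>. The right side is chosen such that it equals
  \<open>3 * a / (a + 3)\<close> at \<open>a = 11\<close>, where the two formulas for \<open>\<eta>*\<close> meet approximately.
\<close>

lemma ln_ge_rational:
  fixes a :: real
  assumes "11 \<le> a"
  shows "12 * a / (3 * a + 23) \<le> ln a"
proof -
  let ?g = "\<lambda>x. ln x - 12 * x / (3 * x + 23)"
  have "?g 11 \<le> ?g a"
  proof (rule DERIV_nonneg_imp_nondecreasing[OF assms])
    fix u :: real assume u: "11 \<le> u" "u \<le> a"
    have "(?g has_real_derivative
        (1 / u - (12 * (3 * u + 23) - 12 * u * 3) / ((3 * u + 23) * (3 * u + 23)))) (at u)"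
      using u by (auto intro!: derivative_eq_intros)
    then have "(?g has_real_derivative (1 / u - 276 / (3 * u + 23)\<^sup>2)) (at u)"
      by (simp add: power2_eq_square)
    moreover have "(3 * u + 23)\<^sup>2 - 276 * u = (3 * u - 23)\<^sup>2"
      by (simp add: algebra_simps power2_eq_square)
    then have "276 * u \<le> (3 * u + 23)\<^sup>2" by (smt (verit) zero_le_power2)
    then have "276 / (3 * u + 23)\<^sup>2 \<le> 1 / u"
      using u by (simp add: divide_simps)
    ultimately show "\<exists>y. (?g has_real_derivative y) (at u) \<and> 0 \<le> y"
      by (intro exI[of _ "1 / u - 276 / (3 * u + 23)\<^sup>2"]) auto
  qed
  then show ?thesis using ln_11_ge by simp
qed

text \<open>
  Each linear factor lies below its exponential tangent at \<open>y\<close>. Hence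
  \<open>z^2 * (z + q) * exp (- p * z)\<close> is bounded by an exponential of a linear function of \<open>z\<close>, which is
  maximal at an endpoint of any interval.
\<close>

lemma sq_cube_exp_le:
  fixes z y q :: real
  assumes "0 < z" "0 < y" "0 \<le> q"
  shows "z\<^sup>2 * (z + q) \<le> y\<^sup>2 * (y + q) * exp ((z - y) * (2 / y + 1 / (y + q)))"
proof -
  have E: "u \<le> v * exp ((u - v) / v)" if "0 < v" for u v :: real
  proof -
    have "u / v \<le> exp (u / v - 1)" using exp_ge_add_one_self[of "u / v - 1"] by simp
    also have "u / v - 1 = (u - v) / v" using that by (simp add: field_simps)
    finally show ?thesis using that by (simp add: field_simps)
  qed
  have "z\<^sup>2 * (z + q) \<le> (y * exp ((z - y) / y))\<^sup>2 * ((y + q) * exp ((z - y) / (y + q)))"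
    using E[of y z] E[of "y + q" "z + q"] assms by (intro mult_mono power_mono) auto
  also have "\<dots> = y\<^sup>2 * (y + q) * exp (2 * ((z - y) / y) + (z - y) / (y + q))"
    by (simp only: power_mult_distrib exp_add exp_double mult_ac)
  also have "2 * ((z - y) / y) + (z - y) / (y + q) = (z - y) * (2 / y + 1 / (y + q))"
    by (simp add: divide_inverse algebra_simps)
  finally show ?thesis .
qed

section \<open>Bounds for the function eta*\<close>

lemma power_rate_le:
  fixes e k d :: real
  assumes "0 < d" "0 < e" "e \<le> 1 / (1 + d)" "0 \<le> k"
  shows "e powr k \<le> exp (- (k * (2 * d / (2 + d))))"
proof -
  have "ln e \<le> ln (1 / (1 + d))" using assms by simp
  also have "\<dots> = - ln (1 + d)" using assms by (simp add: ln_div)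
  also have "\<dots> \<le> - (2 * d / (2 + d))" using ln_one_plus_ge[of d] assms by simp
  finally have "k * ln e \<le> k * (- (2 * d / (2 + d)))" using assms by (intro mult_left_mono) auto
  then show ?thesis using assms by (simp add: powr_def)
qed

lemma eta_star_bounds:
  fixes a :: real
  assumes "0 < a"
  shows "0 < eta_star a" "eta_star a \<le> a / (a + 3)"
    and "11 < a \<Longrightarrow> eta_star a \<le> (3 * a + 11) / (3 * a + 23)"
proof -
  have *: "eta_star a \<le> (3 * a + 11) / (3 * a + 23) \<and> eta_star a \<le> a / (a + 3)" if "11 < a"
  proof -
    have "12 * a / (3 * a + 23) / a \<le> ln a / a"
      using ln_ge_rational[of a] that by (intro divide_right_mono) auto
    then have 1: "12 / (3 * a + 23) \<le> ln a / a" using that by simp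
    have 2: "3 / (a + 3) \<le> 12 / (3 * a + 23)" using that by (simp add: divide_simps)
    have 3: "1 - 12 / (3 * a + 23) = (3 * a + 11) / (3 * a + 23)"
      using that by (simp add: divide_simps)
    have 4: "1 - 3 / (a + 3) = a / (a + 3)" using that by (simp add: divide_simps)
    show ?thesis using that 1 2 3 4 by (simp add: eta_star_def)
  qed
  show "0 < eta_star a" using assms ln_less_self[of a] by (auto simp: eta_star_def)
  show "eta_star a \<le> a / (a + 3)" using * by (cases "11 < a") (auto simp: eta_star_def)
  show "eta_star a \<le> (3 * a + 11) / (3 * a + 23)" if "11 < a" using * that by blast
qed

text \<open>
  The bound \<open>2 * d / (2 + d)\<close> for \<open>ln (1 + d)\<close> has an error of third order in \<open>d\<close> only. This
  accuracy is needed: the coarser \<open>1 - x \<le> exp (- x)\<close> would enlarge the exponential part by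
  more than a third where the bound for \<open>F\<close> is largest.
\<close>

lemma eta_star_powr_le:
  fixes a m :: real
  assumes "0 < a" "3 \<le> m"
  defines "X \<equiv> eta_star a powr ((m - 3) / 2)"
  shows "X \<le> exp (- (3 * (m - 3) / (2 * a + 3)))"
    and "11 < a \<Longrightarrow> X \<le> exp (- (6 * (m - 3) / (3 * a + 17)))"
proof -
  have e: "1 / (1 + 3 / a) = a / (a + 3)" using assms(1) by (simp add: field_simps)
  have "X \<le> exp (- ((m - 3) / 2 * (2 * (3 / a) / (2 + 3 / a))))" unfolding X_def
    using assms eta_star_bounds[of a] e by (intro power_rate_le) auto
  also have "(m - 3) / 2 * (2 * (3 / a) / (2 + 3 / a)) = 3 * (m - 3) / (2 * a + 3)"
    using assms(1) by (simp add: divide_simps) (simp add: algebra_simps)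
  finally show "X \<le> exp (- (3 * (m - 3) / (2 * a + 3)))" .
  assume a: "11 < a"
  let ?d = "12 / (3 * a + 11)"
  have e: "1 / (1 + ?d) = (3 * a + 11) / (3 * a + 23)" using a by (simp add: divide_simps)
  have "X \<le> exp (- ((m - 3) / 2 * (2 * ?d / (2 + ?d))))" unfolding X_def
    using assms eta_star_bounds[of a] e a by (intro power_rate_le) auto
  also have "(m - 3) / 2 * (2 * ?d / (2 + ?d)) = 6 * (m - 3) / (3 * a + 17)"
    using a by (simp add: divide_simps) (simp add: algebra_simps)
  finally show "X \<le> exp (- (6 * (m - 3) / (3 * a + 17)))" .
qed

section \<open>Rational and exponential part of the bound\<close>

text \<open>
  The two parts of the bound for \<open>F\<close>, written in \<open>a = \<alpha>\<close> and \<open>z = m - 2 * a\<close>, so that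
  \<open>m = z + 2 * a\<close>; the argument \<open>X\<close> stands for the power of \<open>\<eta>*\<close>.
\<close>

definition alg_part :: "real \<Rightarrow> real \<Rightarrow> real" where
  "alg_part a z = 1 / 6 + 1 / (4 * (a + 3)) + 1 / (2 * (z + 2 * a)) + 1 / (4 * (a + 3) * (z + 2 * a))
     + 24 * (z + 2 * a)\<^sup>2 * z\<^sup>2 / ((a + 3) * (z + 2 * a + 7) * (z + 2) ^ 4)"

definition exp_part :: "real \<Rightarrow> real \<Rightarrow> real \<Rightarrow> real" where
  "exp_part a z X = (z + 2 * a) * z\<^sup>2 / (20 * (a + 3)) * X"

text \<open>
  The combination \<open>B / m + K * m / (m + 7)\<close> is increasing as soon as the decay of \<open>B / m\<close> is
  dominated, hence it is bounded by its value at the right end \<open>M\<close>, or by its limit \<open>K\<close>.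
\<close>

lemma saturating_le:
  fixes B K m m0 M :: real
  assumes "0 < m0" "m0 \<le> m" "m \<le> M" "0 \<le> K" "B * (m0 + 7) * (M + 7) \<le> 7 * K * m0 * M"
  shows "B / m + K * (m / (m + 7)) \<le> B / M + K * (M / (M + 7))"
proof -
  have pos: "0 < m" "0 < M" using assms by auto
  have "B * (m + 7) * (M + 7) \<le> 7 * K * m * M"
  proof (cases "B \<le> 0")
    case True
    then have "B * (m + 7) * (M + 7) \<le> 0" using pos by (intro mult_nonpos_nonneg) auto
    also have "0 \<le> 7 * K * m * M" using pos assms by simp
    finally show ?thesis .
  next
    case False
    have "m0 * (B * (m + 7) * (M + 7)) \<le> m * (B * (m0 + 7) * (M + 7))"
    proof -
      have "m * (B * (m0 + 7) * (M + 7)) - m0 * (B * (m + 7) * (M + 7)) = 7 * B * (M + 7) * (m - m0)"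
        by (simp add: algebra_simps)
      also have "\<dots> \<ge> 0" using False pos assms by (intro mult_nonneg_nonneg) auto
      finally show ?thesis by simp
    qed
    also have "\<dots> \<le> m * (7 * K * m0 * M)" using assms(5) pos by (intro mult_left_mono) auto
    also have "\<dots> = m0 * (7 * K * m * M)" by (simp add: algebra_simps)
    finally show ?thesis using assms(1) by simp
  qed
  then have "(M - m) * (B * (m + 7) * (M + 7)) \<le> (M - m) * (7 * K * m * M)"
    using assms by (intro mult_left_mono) auto
  moreover have "B / m + K * (m / (m + 7)) - (B / M + K * (M / (M + 7)))
      = ((M - m) * (B * (m + 7) * (M + 7)) - (M - m) * (7 * K * m * M)) / (m * M * (m + 7) * (M + 7))"
    using pos by (simp add: divide_simps) (simp add: algebra_simps)
  ultimately have "B / m + K * (m / (m + 7)) - (B / M + K * (M / (M + 7))) \<le> 0"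
    using pos by (simp add: divide_nonpos_pos)
  then show ?thesis by simp
qed

lemma saturating_le_limit:
  fixes B K m m0 :: real
  assumes "0 < m0" "m0 \<le> m" "0 \<le> B" "B * (m0 + 7) \<le> 7 * K * m0"
  shows "B / m + K * (m / (m + 7)) \<le> K"
proof -
  have "B * m0 \<le> 7 * K * m0" using assms(3,4) by (simp add: distrib_left)
  then have "0 \<le> 7 * K - B" using assms(1) by simp
  then have "(7 * K - B) * m0 \<le> (7 * K - B) * m" using assms by (intro mult_left_mono) auto
  then have "B * (m + 7) \<le> 7 * K * m" using assms by (simp add: algebra_simps)
  then show ?thesis using assms by (simp add: divide_simps) (simp add: algebra_simps)
qed

lemma ratio_decreasing:
  fixes a b z :: real
  assumes "0 \<le> b" "b \<le> a" "6 \<le> z"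
  shows "(z + 2 * a) / (a + 3) \<le> (z + 2 * b) / (b + 3)"
proof -
  have "(z + 2 * b) * (a + 3) - (z + 2 * a) * (b + 3) = (z - 6) * (a - b)"
    by (simp add: algebra_simps)
  also have "\<dots> \<ge> 0" using assms by simp
  finally show ?thesis using assms by (simp add: divide_simps)
qed

text \<open>
  At fixed \<open>z \<ge> 6\<close> the ratio \<open>(z + 2 * a) / (a + 3) = 2 + (z - 6) / (a + 3)\<close> decreases in \<open>a\<close>.
  The remaining function of \<open>z\<close> is a combination of \<open>z^3 / (z + 2)^4\<close> and \<open>z^2 / (z + 2)^4\<close>, which
  decrease for \<open>z \<ge> 6\<close> and \<open>z \<ge> 2\<close>, respectively.
\<close>

lemma peak_decreasing:
  fixes a a0 z z0 :: real
  assumes "0 \<le> a0" "a0 \<le> a" "6 \<le> z0" "z0 \<le> z"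
  shows "(z + 2 * a) * z\<^sup>2 / ((a + 3) * (z + 2) ^ 4)
    \<le> (z0 + 2 * a0) * z0\<^sup>2 / ((a0 + 3) * (z0 + 2) ^ 4)"
proof -
  have split: "(x + 2 * a0) / (a0 + 3) * (x\<^sup>2 / (x + 2) ^ 4)
      = (x ^ 3 / (x + 2) ^ 4 + 2 * a0 * (x / (x + 2)\<^sup>2)\<^sup>2) / (a0 + 3)" for x :: real
  proof -
    have "(x + 2 * a0) / (a0 + 3) * (x\<^sup>2 / w) = (x ^ 3 / w + 2 * a0 * (x\<^sup>2 / w)) / (a0 + 3)" for w
      by (simp add: algebra_simps add_divide_distrib power2_eq_square power3_eq_cube)
    moreover have "(x / (x + 2)\<^sup>2)\<^sup>2 = x\<^sup>2 / (x + 2) ^ 4" by (simp add: power_divide flip: power_mult)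
    ultimately show ?thesis by presburger
  qed
  have "(z + 2 * a) / (a + 3) \<le> (z + 2 * a0) / (a0 + 3)"
    using assms by (intro ratio_decreasing) auto
  then have "(z + 2 * a) / (a + 3) * (z\<^sup>2 / (z + 2) ^ 4) \<le> (z + 2 * a0) / (a0 + 3) * (z\<^sup>2 / (z + 2) ^ 4)"
    by (intro mult_right_mono) auto
  also have "\<dots> = (z ^ 3 / (z + 2) ^ 4 + 2 * a0 * (z / (z + 2)\<^sup>2)\<^sup>2) / (a0 + 3)"
    by (rule split)
  also have "\<dots> \<le> (z0 ^ 3 / (z0 + 2) ^ 4 + 2 * a0 * (z0 / (z0 + 2)\<^sup>2)\<^sup>2) / (a0 + 3)"
  proof (intro divide_right_mono add_mono mult_left_mono power_mono)
    have "z0 * (z + 2)\<^sup>2 - z * (z0 + 2)\<^sup>2 = (z - z0) * (z * z0 - 4)"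
      by (simp add: algebra_simps power2_eq_square)
    moreover have "6 * 6 \<le> z * z0" using assms by (intro mult_mono) auto
    ultimately have "z * (z0 + 2)\<^sup>2 \<le> z0 * (z + 2)\<^sup>2" using assms by (smt (verit) mult_nonneg_nonneg)
    then show "z / (z + 2)\<^sup>2 \<le> z0 / (z0 + 2)\<^sup>2" using assms by (simp add: divide_simps)
    define s where "s = (z / z0 - 1) / 4"
    have s: "0 \<le> s" "z = z0 * (1 + 4 * s)" using assms by (auto simp: s_def field_simps)
    have "(1 + 4 * s) ^ 3 \<le> (1 + 3 * s) ^ 4"
    proof -
      have "(1 + 3 * s) ^ 4 - (1 + 4 * s) ^ 3 = 6 * s ^ 2 + 44 * s ^ 3 + 81 * s ^ 4"
        by (simp add: power2_eq_square power3_eq_cube power4_eq_xxxx algebra_simps)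
      also have "\<dots> \<ge> 0" using s by simp
      finally show ?thesis by simp
    qed
    then have "z0 ^ 3 * (z0 + 2) ^ 4 * (1 + 4 * s) ^ 3 \<le> z0 ^ 3 * (z0 + 2) ^ 4 * (1 + 3 * s) ^ 4"
      using assms by (intro mult_left_mono) auto
    also have "\<dots> = z0 ^ 3 * ((z0 + 2) * (1 + 3 * s)) ^ 4" by (simp add: power_mult_distrib)
    also have "\<dots> \<le> z0 ^ 3 * (z + 2) ^ 4"
    proof (intro mult_left_mono power_mono)
      have "s * 6 \<le> s * z0" using s assms by (intro mult_left_mono) auto
      then show "(z0 + 2) * (1 + 3 * s) \<le> z + 2" by (simp add: s(2) algebra_simps)
    qed (use s assms in auto)
    finally have "z ^ 3 * (z0 + 2) ^ 4 \<le> z0 ^ 3 * (z + 2) ^ 4"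
      by (simp only: s(2) power_mult_distrib mult_ac)
    then show "z ^ 3 / (z + 2) ^ 4 \<le> z0 ^ 3 / (z0 + 2) ^ 4" using assms by (simp add: divide_simps)
  qed (use assms in auto)
  also have "\<dots> = (z0 + 2 * a0) / (a0 + 3) * (z0\<^sup>2 / (z0 + 2) ^ 4)"
    by (rule split[symmetric])
  finally show ?thesis by simp
qed

lemma alg_part_le:
  fixes a a0 z z0 :: real
  assumes "0 \<le> a0" "a0 \<le> a" "6 \<le> z0" "z0 \<le> z"
    and K: "24 * ((z0 + 2 * a0) * z0\<^sup>2 / ((a0 + 3) * (z0 + 2) ^ 4)) \<le> K"
    and B: "1 / 2 + 1 / (4 * (a0 + 3)) \<le> B"
  shows "alg_part a z \<le> 1 / 6 + 1 / (4 * (a0 + 3))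
    + (B / (z + 2 * a) + K * ((z + 2 * a) / (z + 2 * a + 7)))"
proof -
  define m where "m = z + 2 * a"
  have m: "0 < m" using assms by (simp add: m_def)
  have r: "1 / (4 * (a + 3)) \<le> 1 / (4 * (a0 + 3))" using assms by (simp add: divide_simps)
  have "1 / (2 * m) + 1 / (4 * (a + 3) * m) = (1 / 2 + 1 / (4 * (a + 3))) / m"
    using m by (simp add: add_divide_distrib)
  also have "\<dots> \<le> B / m" using B r m by (intro divide_right_mono) auto
  finally have 1: "1 / (2 * m) + 1 / (4 * (a + 3) * m) \<le> B / m" .
  have "24 * m\<^sup>2 * z\<^sup>2 / ((a + 3) * (m + 7) * (z + 2) ^ 4)
      = 24 * ((z + 2 * a) * z\<^sup>2 / ((a + 3) * (z + 2) ^ 4)) * (m / (m + 7))"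
    by (simp add: m_def power2_eq_square mult_ac)
  also have "\<dots> \<le> K * (m / (m + 7))"
    using peak_decreasing[OF assms(1-4)] K m by (intro mult_right_mono) auto
  finally show ?thesis using 1 r unfolding alg_part_def by (simp add: m_def)
qed

text \<open>
  On a rectangle, \<open>K\<close> bounds the peak at the lower left corner and \<open>M\<close> bounds \<open>m = z + 2 * a\<close>
  from above; the next lemma is the version for unbounded \<open>z\<close>.
\<close>

lemma alg_part_le_box:
  fixes a a0 z z0 :: real
  assumes "0 \<le> a0" "a0 \<le> a" "6 \<le> z0" "z0 \<le> z" "z + 2 * a \<le> M"
    and "24 * ((z0 + 2 * a0) * z0\<^sup>2 / ((a0 + 3) * (z0 + 2) ^ 4)) \<le> K"
    and "1 / 2 + 1 / (4 * (a0 + 3)) \<le> B"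
    and "B * (z0 + 2 * a0 + 7) * (M + 7) \<le> 7 * K * (z0 + 2 * a0) * M"
    and "1 / 6 + 1 / (4 * (a0 + 3)) + (B / M + K * (M / (M + 7))) \<le> r"
  shows "alg_part a z \<le> r"
proof -
  have "0 \<le> 24 * ((z0 + 2 * a0) * z0\<^sup>2 / ((a0 + 3) * (z0 + 2) ^ 4))" using assms by simp
  with assms(6) have "0 \<le> K" by linarith
  then have "B / (z + 2 * a) + K * ((z + 2 * a) / (z + 2 * a + 7)) \<le> B / M + K * (M / (M + 7))"
    using assms by (intro saturating_le[of "z0 + 2 * a0"]) auto
  with alg_part_le[OF assms(1-4,6,7)] assms(9) show ?thesis by linarith
qed

lemma alg_part_le_strip:
  fixes a a0 z z0 :: real
  assumes "0 \<le> a0" "a0 \<le> a" "6 \<le> z0" "z0 \<le> z"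
    and "24 * ((z0 + 2 * a0) * z0\<^sup>2 / ((a0 + 3) * (z0 + 2) ^ 4)) \<le> K"
    and "1 / 2 + 1 / (4 * (a0 + 3)) \<le> B"
    and "0 \<le> B" "B * (z0 + 2 * a0 + 7) \<le> 7 * K * (z0 + 2 * a0)"
    and "1 / 6 + 1 / (4 * (a0 + 3)) + K \<le> r"
  shows "alg_part a z \<le> r"
proof -
  have "B / (z + 2 * a) + K * ((z + 2 * a) / (z + 2 * a + 7)) \<le> K"
    using assms by (intro saturating_le_limit[of "z0 + 2 * a0"]) auto
  with alg_part_le[OF assms(1-6)] assms(9) show ?thesis by linarith
qed

lemma exp_part_le:
  fixes y z q E f w :: real
  assumes "0 < z" "0 < y" "0 \<le> q" "0 \<le> f"
    and "(z - y) * (2 / y + 1 / (y + q)) - E \<le> - (real n + f)"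
    and "y\<^sup>2 * (y + q) \<le> w * (2.718 ^ n * (1 + f / 8 + (f / 8)\<^sup>2 / 2) ^ 8)"
  shows "z\<^sup>2 * (z + q) * exp (- E) \<le> w"
proof -
  define V where "V = y\<^sup>2 * (y + q)"
  define R :: real where "R = 2.718 ^ n * (1 + f / 8 + (f / 8)\<^sup>2 / 2) ^ 8"
  have V: "0 < V" using assms by (simp add: V_def add_pos_nonneg)
  have "V \<le> w * R" using assms(6) by (simp add: V_def R_def)
  then have "1 \<le> w / V * R" using V by (simp add: pos_le_divide_eq)
  have "z\<^sup>2 * (z + q) * exp (- E) \<le> V * exp ((z - y) * (2 / y + 1 / (y + q))) * exp (- E)"
    unfolding V_def using sq_cube_exp_le[of z y q] assms by (intro mult_right_mono) auto
  also have "\<dots> = V * exp ((z - y) * (2 / y + 1 / (y + q)) - E)"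
    by (simp add: exp_diff exp_minus divide_inverse mult_ac)
  also have "\<dots> \<le> V * exp (- (real n + f))"
    using V assms(5) by (intro mult_left_mono) auto
  also have "\<dots> \<le> V * (w / V)"
    using V assms(4) \<open>1 \<le> w / V * R\<close> by (intro mult_left_mono exp_minus_le) (auto simp: R_def)
  finally show ?thesis using V by simp
qed

lemma exp_ratio_le:
  fixes P Q u v :: real
  assumes "0 < Q" "P \<le> Q * (1 + (v - u))"
  shows "P * exp (- v) \<le> Q * exp (- u)"
proof -
  have "P * exp (- v) \<le> Q * exp (v - u) * exp (- v)"
    using assms exp_ge_add_one_self[of "v - u"]
    by (intro mult_right_mono) (auto intro: order_trans[OF assms(2)])
  also have "\<dots> = Q * exp (- u)" by (simp add: exp_diff exp_minus field_simps)
  finally show ?thesis .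
qed

text \<open>
  Increasing \<open>a\<close> to \<open>b\<close> lowers the rational factor by a relative amount that is at most the
  increase of the exponent, and \<open>1 + x \<le> exp x\<close> converts one into the other.
\<close>

lemma exp_part_mono_small:
  fixes a b z :: real
  assumes "0 \<le> a" "a \<le> b" "6 \<le> z"
  shows "(z + 2 * a) / (a + 3) * exp (- (3 * (z + 2 * a - 3) / (2 * a + 3)))
    \<le> (z + 2 * b) / (b + 3) * exp (- (3 * (z + 2 * b - 3) / (2 * b + 3)))"
proof (rule exp_ratio_le)
  have "3 * (z + 2 * a - 3) / (2 * a + 3) - 3 * (z + 2 * b - 3) / (2 * b + 3)
      = 6 * (z - 6) * (b - a) / ((2 * a + 3) * (2 * b + 3))"
    using assms by (simp add: divide_simps) (simp add: algebra_simps)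
  moreover have "(z + 2 * a) / (a + 3) = (z + 2 * b) / (b + 3) + (z - 6) * (b - a) / ((a + 3) * (b + 3))"
    using assms by (simp add: divide_simps) (simp add: algebra_simps)
  moreover have "(z - 6) * (b - a) / ((a + 3) * (b + 3))
      \<le> (z + 2 * b) / (b + 3) * (6 * (z - 6) * (b - a) / ((2 * a + 3) * (2 * b + 3)))"
  proof -
    have "(2 * a + 3) * (2 * b + 3) \<le> (2 * (a + 3)) * (3 * (z + 2 * b))"
      using assms by (intro mult_mono) auto
    then have "1 / (a + 3) \<le> (z + 2 * b) * 6 / ((2 * a + 3) * (2 * b + 3))"
      using assms by (simp add: divide_simps) (simp add: algebra_simps)
    then have "(z - 6) * (b - a) / (b + 3) * (1 / (a + 3))
        \<le> (z - 6) * (b - a) / (b + 3) * ((z + 2 * b) * 6 / ((2 * a + 3) * (2 * b + 3)))"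
      using assms by (intro mult_left_mono) auto
    then show ?thesis
      by (simp add: mult_ac del: right_diff_distrib_numeral left_diff_distrib_numeral
          distrib_left_numeral distrib_right_numeral)
  qed
  ultimately show "(z + 2 * a) / (a + 3) \<le> (z + 2 * b) / (b + 3)
      * (1 + (3 * (z + 2 * a - 3) / (2 * a + 3) - 3 * (z + 2 * b - 3) / (2 * b + 3)))"
    by (simp add: distrib_left)
qed (use assms in \<open>simp add: add_pos_pos\<close>)

text \<open>
  The same comparison as in \<open>exp_part_mono_small\<close>, now with the rate valid for \<open>a > 11\<close> and
  the right end \<open>a = 17\<close>. Here the exponent decreases in \<open>a\<close> fast enough only if \<open>z\<close> is not too small.
\<close>

lemma exp_part_mono_large:
  fixes a z :: real
  assumes "11 \<le> a" "a \<le> 17" "35 / 2 \<le> z"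
  shows "(z + 2 * a) / (a + 3) * exp (- (6 * (z + 2 * a - 3) / (3 * a + 17)))
    \<le> (z + 34) / 20 * exp (- (4 + (3 * z - 43) / 34))"
proof (rule exp_ratio_le)
  have "6 * (z + 2 * a - 3) / (3 * a + 17) - (4 + (3 * z - 43) / 34)
      = 3 * (3 * z - 43) * (17 - a) / (34 * (3 * a + 17))"
    using assms by (simp add: divide_simps) (simp add: algebra_simps)
  moreover have "(z + 2 * a) / (a + 3) = (z + 34) / 20 + (z - 6) * (17 - a) / (20 * (a + 3))"
    using assms by (simp add: divide_simps) (simp add: algebra_simps)
  moreover have "(z - 6) * (17 - a) / (20 * (a + 3))
      \<le> (z + 34) / 20 * (3 * (3 * z - 43) * (17 - a) / (34 * (3 * a + 17)))"
  proof -
    have "34 * (3 * a + 17) \<le> 122 * (a + 3)" using assms by simp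
    then have "(z - 6) * (34 * (3 * a + 17)) \<le> (z - 6) * (122 * (a + 3))"
      using assms by (intro mult_left_mono) auto
    also have "\<dots> = (122 * (z - 6)) * (a + 3)" by (simp only: mult_ac)
    also have "\<dots> \<le> (3 * (3 * z - 43) * (z + 34)) * (a + 3)"
    proof (intro mult_right_mono)
      have "3 * (3 * z - 43) * (z + 34) - 122 * (z - 6)
          = 9 * (z - 35 / 2)\<^sup>2 + 370 * (z - 35 / 2) + 259 / 4"
        by (simp add: algebra_simps power2_eq_square)
      also have "\<dots> \<ge> 0" using assms by (intro add_nonneg_nonneg) auto
      finally show "122 * (z - 6) \<le> 3 * (3 * z - 43) * (z + 34)" by simp
    qed (use assms in auto)
    finally have "(z - 6) / (a + 3) \<le> (z + 34) * (3 * (3 * z - 43)) / (34 * (3 * a + 17))"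
      using assms by (simp add: divide_simps) (simp add: algebra_simps)
    then have "(17 - a) / 20 * ((z - 6) / (a + 3))
        \<le> (17 - a) / 20 * ((z + 34) * (3 * (3 * z - 43)) / (34 * (3 * a + 17)))"
      using assms by (intro mult_left_mono) auto
    then show ?thesis
      by (simp add: mult_ac del: right_diff_distrib_numeral left_diff_distrib_numeral
          distrib_left_numeral distrib_right_numeral)
  qed
  ultimately show "(z + 2 * a) / (a + 3) \<le> (z + 34) / 20
      * (1 + (6 * (z + 2 * a - 3) / (3 * a + 17) - (4 + (3 * z - 43) / 34)))"
    by (simp only: distrib_left)
qed (use assms in simp)

section \<open>The region z at least 6\<close>

lemma exp_part_le_at:
  fixes a b z X :: real
  assumes "0 \<le> a" "0 \<le> b" "0 < z"
    and X: "X \<le> exp (- v)"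
    and mono: "(z + 2 * a) / (a + 3) * exp (- v) \<le> (z + 2 * b) / (b + 3) * exp (- u)"
    and bound: "z\<^sup>2 * (z + 2 * b) * exp (- u) \<le> w"
  shows "exp_part a z X \<le> w / (20 * (b + 3))"
proof -
  have "exp_part a z X = z\<^sup>2 / 20 * ((z + 2 * a) / (a + 3) * X)"
    by (simp add: exp_part_def mult_ac)
  also have "\<dots> \<le> z\<^sup>2 / 20 * ((z + 2 * a) / (a + 3) * exp (- v))"
    using assms by (intro mult_left_mono) auto
  also have "\<dots> \<le> z\<^sup>2 / 20 * ((z + 2 * b) / (b + 3) * exp (- u))"
    using mono by (intro mult_left_mono) auto
  also have "\<dots> = (z\<^sup>2 * (z + 2 * b) * exp (- u)) / (20 * (b + 3))"
    by (simp add: mult_ac)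
  also have "\<dots> \<le> w / (20 * (b + 3))" using bound assms by (intro divide_right_mono) auto
  finally show ?thesis .
qed

lemma exp_part_le_6:
  fixes a z X :: real
  assumes "0 \<le> a" "a \<le> 6" "6 \<le> z" "X \<le> exp (- (3 * (z + 2 * a - 3) / (2 * a + 3)))"
    and "z\<^sup>2 * (z + 12) * exp (- ((z + 9) / 5)) \<le> w"
  shows "exp_part a z X \<le> w / 180"
proof -
  have u: "3 * (z + 2 * 6 - 3) / (2 * 6 + 3) = (z + 9) / 5" by simp
  have "exp_part a z X \<le> w / (20 * (6 + 3))"
    by (rule exp_part_le_at[OF _ _ _ assms(4) exp_part_mono_small[of a 6 z, unfolded u]])
      (use assms in auto)
  then show ?thesis by simp
qed

text \<open>
  For \<open>a > 11\<close> and \<open>3 * z \<le> 43\<close> the exponent \<open>4 + (3 * z - 43) / E\<close> with \<open>E = (3 * a + 17) / 2\<close>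
  increases with \<open>a\<close>, so that \<open>a = 11\<close> is the worst case on both sides of \<open>11\<close>.
\<close>

lemma exp_part_le_11:
  fixes a z X :: real
  assumes "0 \<le> a" "6 \<le> z" "X \<le> exp (- (3 * (z + 2 * a - 3) / (2 * a + 3)))"
    and large: "11 < a \<Longrightarrow> X \<le> exp (- (6 * (z + 2 * a - 3) / (3 * a + 17)))"
    and "a \<le> 11 \<or> 3 * z \<le> 43"
    and "z\<^sup>2 * (z + 22) * exp (- (3 * (z + 19) / 25)) \<le> w"
  shows "exp_part a z X \<le> w / 280"
proof -
  have "exp_part a z X \<le> w / (20 * (11 + 3))"
  proof (cases "a \<le> 11")
    case True
    have u: "3 * (z + 2 * 11 - 3) / (2 * 11 + 3) = 3 * (z + 19) / 25" by simp
    show ?thesis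
      by (rule exp_part_le_at[OF _ _ _ assms(3) exp_part_mono_small[of a 11 z, unfolded u]])
        (use True assms in auto)
  next
    case False
    have "6 * (z + 2 * a - 3) / (3 * a + 17) - 3 * (z + 19) / 25
        = 3 * (43 - 3 * z) * (a - 11) / (25 * (3 * a + 17))"
      using False by (simp add: divide_simps) (simp add: algebra_simps)
    also have "\<dots> \<ge> 0" using False assms(5) by simp
    finally have "exp (- (6 * (z + 2 * a - 3) / (3 * a + 17))) \<le> exp (- (3 * (z + 19) / 25))"
      by simp
    with large False have X: "X \<le> exp (- (3 * (z + 19) / 25))" by linarith
    have "(z + 2 * a) / (a + 3) \<le> (z + 2 * 11) / (11 + 3)"
      using False assms by (intro ratio_decreasing) auto
    then show ?thesis
      using False assms by (intro exp_part_le_at[OF _ _ _ X, where u = "3 * (z + 19) / 25"] mult_right_mono) auto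
  qed
  then show ?thesis by simp
qed

text \<open>
  Between the ranges of \<open>exp_part_le_11\<close> and \<open>exp_part_le_17\<close> the two factors are estimated
  separately, the rational one at \<open>a = 11\<close> and the exponential one at \<open>a = 17\<close>.
\<close>

lemma exp_part_le_mid:
  fixes a z X :: real
  assumes "11 < a" "a \<le> 17" "43 / 3 \<le> z"
    and X: "X \<le> exp (- (6 * (z + 2 * a - 3) / (3 * a + 17)))"
    and "z\<^sup>2 * (z + 22) * exp (- (4 + (3 * z - 43) / 34)) \<le> w"
  shows "exp_part a z X \<le> w / 280"
proof -
  have "6 * (z + 2 * a - 3) / (3 * a + 17) - (4 + (3 * z - 43) / 34)
      = 3 * (3 * z - 43) * (17 - a) / (34 * (3 * a + 17))"
    using assms by (simp add: divide_simps) (simp add: algebra_simps)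
  also have "\<dots> \<ge> 0" using assms by simp
  finally have "exp (- (6 * (z + 2 * a - 3) / (3 * a + 17))) \<le> exp (- (4 + (3 * z - 43) / 34))"
    by simp
  with X have X: "X \<le> exp (- (4 + (3 * z - 43) / 34))" by linarith
  have "(z + 2 * a) / (a + 3) \<le> (z + 2 * 11) / (11 + 3)"
    using assms by (intro ratio_decreasing) auto
  then have "exp_part a z X \<le> w / (20 * (11 + 3))"
    using assms
    by (intro exp_part_le_at[OF _ _ _ X, where u = "4 + (3 * z - 43) / 34"] mult_right_mono) auto
  then show ?thesis by simp
qed

lemma exp_part_le_17:
  fixes a z X :: real
  assumes "11 < a" "a \<le> 17" "35 / 2 \<le> z"
    and X: "X \<le> exp (- (6 * (z + 2 * a - 3) / (3 * a + 17)))"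
    and "z\<^sup>2 * (z + 34) * exp (- (4 + (3 * z - 43) / 34)) \<le> w"
  shows "exp_part a z X \<le> w / 400"
proof -
  have "exp_part a z X \<le> w / (20 * (17 + 3))"
    by (rule exp_part_le_at[OF _ _ _ X, where u = "4 + (3 * z - 43) / 34"])
      (use assms exp_part_mono_large[of a z] in auto)
  then show ?thesis by simp
qed

text \<open>
  In every case \<open>y\<close> is the point where \<open>sq_cube_exp_le\<close> touches: the right end of the
  \<open>z\<close>-interval where the exponential part still increases, and a point close to its maximum in the three
  unbounded cases. The number \<open>n + f\<close> is the resulting exponent at the worst end, rounded down, and \<open>K\<close>
  is the value of \<open>24 * peak\<close> at the lower left corner, rounded up.
\<close>

lemma sum_lt_z_ge_6:
  fixes a z X :: real
  assumes a: "0 < a" "a \<le> 17" and z: "6 \<le> z"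
    and X: "X \<le> exp (- (3 * (z + 2 * a - 3) / (2 * a + 3)))"
    and X': "11 < a \<Longrightarrow> X \<le> exp (- (6 * (z + 2 * a - 3) / (3 * a + 17)))"
  shows "alg_part a z + exp_part a z X < 0.966537"
proof -
  consider "a \<le> 6" | "6 < a" "a \<le> 11" "z \<le> 11" | "6 < a" "a \<le> 11" "11 < z" "z \<le> 15"
    | "6 < a" "a \<le> 11" "15 < z"
    | "11 < a" "z \<le> 11" | "11 < a" "11 < z" "z \<le> 43 / 3" | "11 < a" "43 / 3 < z" "z \<le> 35 / 2"
    | "11 < a" "35 / 2 < z" "z \<le> 45 / 2" | "11 < a" "45 / 2 < z" by linarith
  then show ?thesis
  proof cases
    case 1
    have "alg_part a z \<le> 0.671875"
      by (rule alg_part_le_strip[of 0 a 6 z "0.421875" "7 / 12"])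
        (use a z in \<open>simp_all add: power2_eq_square power4_eq_xxxx\<close>)
    moreover have "exp_part a z X \<le> 53 / 180"
      by (rule exp_part_le_6[OF _ 1 z X], use a in simp)
        (rule exp_part_le[where y = "12.6" and n = 4 and f = "0.3159"],
          use z in \<open>simp_all add: power2_eq_square power_divide field_simps\<close>)
    ultimately show ?thesis by simp
  next
    case 2
    have "alg_part a z \<le> 0.56"
      by (rule alg_part_le_box[of 6 a 6 z 33 "0.421875" "0.5278"])
        (use 2 z in \<open>simp_all add: power2_eq_square power4_eq_xxxx\<close>)
    moreover have "exp_part a z X \<le> 112 / 280"
      by (rule exp_part_le_11[OF _ z X X'], use 2 in simp, assumption, use 2 in simp)
        (rule exp_part_le[where y = "11" and n = 3 and f = "0.6"],
          use z 2 in \<open>simp_all add: power2_eq_square power_divide field_simps\<close>)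
    ultimately show ?thesis by simp
  next
    case 3
    have "alg_part a z \<le> 0.4285"
      by (rule alg_part_le_box[of 6 a 11 z 37 "0.25985" "0.5278"])
        (use 3 z in \<open>simp_all add: power2_eq_square power4_eq_xxxx\<close>)
    moreover have "exp_part a z X \<le> 145 / 280"
      by (rule exp_part_le_11[OF _ z X X'], use 3 in simp, assumption, use 3 in simp)
        (rule exp_part_le[where y = "15" and n = 4 and f = "0.08"],
          use z 3 in \<open>simp_all add: power2_eq_square power_divide field_simps\<close>)
    ultimately show ?thesis by simp
  next
    case 4
    have "alg_part a z \<le> 0.38842"
      by (rule alg_part_le_strip[of 6 a 15 z "0.19397" "0.5278"])
        (use 4 z in \<open>simp_all add: power2_eq_square power4_eq_xxxx\<close>)
    moreover have "exp_part a z X \<le> 160 / 280"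
      by (rule exp_part_le_11[OF _ z X X'], use 4 in simp, assumption, use 4 in simp)
        (rule exp_part_le[where y = "21" and n = 4 and f = "0.79"],
          use z 4 in \<open>simp_all add: power2_eq_square power_divide field_simps\<close>)
    ultimately show ?thesis by simp
  next
    case 5
    have "alg_part a z \<le> 0.5625"
      by (rule alg_part_le_box[of 11 a 6 z 45 "0.421875" "0.51786"])
        (use 5 a z in \<open>simp_all add: power2_eq_square power4_eq_xxxx\<close>)
    moreover have "exp_part a z X \<le> 112 / 280"
      by (rule exp_part_le_11[OF _ z X X'], use 5 in simp, assumption, use 5 in simp)
        (rule exp_part_le[where y = "11" and n = 3 and f = "0.6"],
          use z 5 in \<open>simp_all add: power2_eq_square power_divide field_simps\<close>)
    ultimately show ?thesis by simp
  next
    case 6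
    have "alg_part a z \<le> 0.41"
      by (rule alg_part_le_box[of 11 a 11 z "145 / 3" "0.23967" "0.51786"])
        (use 6 a z in \<open>simp_all add: power2_eq_square power4_eq_xxxx\<close>)
    moreover have "exp_part a z X \<le> 145 / 280"
      by (rule exp_part_le_11[OF _ z X X'], use 6 in simp, assumption, use 6 in simp)
        (rule exp_part_le[where y = "43 / 3" and n = 4 and f = 0],
          use z 6 in \<open>simp_all add: power2_eq_square power_divide field_simps\<close>)
    ultimately show ?thesis by simp
  next
    case 7
    have "alg_part a z \<le> 0.354"
      by (rule alg_part_le_box[of 11 a "43 / 3" z "103 / 2" "0.1798" "0.51786"])
        (use 7 a z in \<open>simp_all add: power2_eq_square power4_eq_xxxx\<close>)
    moreover have "exp_part a z X \<le> 171 / 280"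
      by (rule exp_part_le_mid[OF 7(1) a(2) _ X'], use 7 in simp, use 7 in simp)
        (rule exp_part_le[where y = "35 / 2" and n = 4 and f = "0.279"],
          use z 7 in \<open>simp_all add: power2_eq_square power_divide field_simps\<close>)
    ultimately show ?thesis by simp
  next
    case 8
    have "alg_part a z \<le> 0.322"
      by (rule alg_part_le_box[of 11 a "35 / 2" z "113 / 2" "0.14343" "0.51786"])
        (use 8 a z in \<open>simp_all add: power2_eq_square power4_eq_xxxx\<close>)
    moreover have "exp_part a z X \<le> 257 / 400"
      by (rule exp_part_le_17[OF 8(1) a(2) _ X'], use 8 in simp, use 8 in simp)
        (rule exp_part_le[where y = "45 / 2" and n = 4 and f = "0.72"],
          use z 8 in \<open>simp_all add: power2_eq_square power_divide field_simps\<close>)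
    ultimately show ?thesis by simp
  next
    case 9
    have "alg_part a z \<le> 0.29172"
      by (rule alg_part_le_strip[of 11 a "45 / 2" z "0.10719" "0.51786"])
        (use 9 a z in \<open>simp_all add: power2_eq_square power4_eq_xxxx\<close>)
    moreover have "exp_part a z X \<le> 269.8 / 400"
      by (rule exp_part_le_17[OF 9(1) a(2) _ X'], use 9 in simp, use 9 in simp)
        (rule exp_part_le[where y = 28 and n = 5 and f = "0.202"],
          use z 9 in \<open>simp_all add: power2_eq_square power_divide field_simps\<close>)
    ultimately show ?thesis by simp
  qed
qed

section \<open>The region z at most 6\<close>

text \<open>
  Here \<open>m / (a + 3) = 2 * (1 - (6 - z) / (2 * a + 6))\<close>, and estimating the second factor by an
  exponential collects the whole dependence on \<open>a\<close> in the exponent.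
\<close>

lemma exp_part_le_low:
  fixes a z X :: real
  assumes "0 < a" "0 < z" "z \<le> 6"
    and X: "X \<le> exp (- (3 * (z + 2 * a - 3) / (2 * a + 3)))"
  shows "exp_part a z X
    \<le> z\<^sup>2 / 10 * exp ((6 - z) * (3 / (2 * a + 3) - 1 / (2 * a + 6)) - 3)"
proof -
  have D: "0 < 2 * a + 3" "0 < 2 * a + 6" using assms by auto
  have "(z + 2 * a) / (a + 3) = 2 * (1 - (6 - z) / (2 * a + 6))"
    using assms by (simp add: field_simps)
  also have "\<dots> \<le> 2 * exp (- ((6 - z) / (2 * a + 6)))"
    using exp_ge_add_one_self[of "- ((6 - z) / (2 * a + 6))"] by (intro mult_left_mono) simp_all
  finally have 1: "(z + 2 * a) / (a + 3) \<le> 2 * exp (- ((6 - z) / (2 * a + 6)))" .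
  have 2: "3 * (z + 2 * a - 3) / (2 * a + 3) = 3 - (6 - z) * (3 / (2 * a + 3))"
    using D by (simp add: divide_simps)
  have "exp_part a z X = z\<^sup>2 / 20 * ((z + 2 * a) / (a + 3) * X)"
    by (simp add: exp_part_def mult_ac)
  also have "\<dots> \<le> z\<^sup>2 / 20 * ((z + 2 * a) / (a + 3) * exp (- (3 - (6 - z) * (3 / (2 * a + 3)))))"
    using assms by (intro mult_left_mono X[unfolded 2]) auto
  also have "\<dots> \<le> z\<^sup>2 / 20 * (2 * exp (- ((6 - z) / (2 * a + 6)))
      * exp (- (3 - (6 - z) * (3 / (2 * a + 3)))))"
    using 1 by (intro mult_left_mono mult_right_mono) auto
  also have "\<dots> = z\<^sup>2 / 10 * exp (- ((6 - z) / (2 * a + 6)) + - (3 - (6 - z) * (3 / (2 * a + 3))))"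
    by (simp only: exp_add mult_ac)
  also have "- ((6 - z) / (2 * a + 6)) + - (3 - (6 - z) * (3 / (2 * a + 3)))
      = (6 - z) * (3 / (2 * a + 3) - 1 / (2 * a + 6)) - 3"
    by (simp add: right_diff_distrib)
  finally show ?thesis .
qed

lemma sq_exp_le:
  fixes y z :: real
  assumes "0 < z" "0 < y"
  shows "z\<^sup>2 \<le> y\<^sup>2 * exp (2 * ((z - y) / y))"
proof -
  have "z / y \<le> exp ((z - y) / y)"
    using exp_ge_add_one_self[of "(z - y) / y"] assms by (simp add: field_simps)
  then have "(z / y)\<^sup>2 \<le> (exp ((z - y) / y))\<^sup>2" using assms by (intro power_mono) auto
  then show ?thesis using assms by (simp only: exp_double) (simp add: field_simps)
qed

text \<open>
  With \<open>D = 2 * a + 3\<close> the condition \<open>m \<ge> 5\<close> reads \<open>6 - z \<le> D - 2\<close>; since \<open>z^2\<close> is at most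
  \<open>36 * exp (- (6 - z) / 3)\<close>, this bounds the exponent of the exponential part by a function of \<open>D\<close>
  alone. The rational part increases with \<open>a\<close> up to \<open>a = 2\<close>, except for its decreasing terms, which are
  estimated at \<open>a = 0\<close> and \<open>m = 5\<close>.
\<close>

lemma sum_lt_small_a:
  fixes a z X :: real
  assumes a: "0 < a" "a < 2" and z: "0 < z" "z \<le> 6" and m: "5 \<le> z + 2 * a"
    and X: "X \<le> exp (- (3 * (z + 2 * a - 3) / (2 * a + 3)))"
  shows "alg_part a z + exp_part a z X < 0.966537"
proof -
  define m where "m = z + 2 * a"
  have m5: "5 \<le> m" using m by (simp add: m_def)
  have b: "1 / (4 * (a + 3)) \<le> 1 / 12" using a by (simp add: divide_simps)
  have i: "1 / (2 * m) \<le> 1 / 10" using m5 by (simp add: divide_simps)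
  have "4 * 3 * 5 \<le> 4 * (a + 3) * m" using m5 a by (intro mult_mono) auto
  then have bi: "1 / (4 * (a + 3) * m) \<le> 1 / 60" using m5 a by (simp add: divide_simps)
  have r1: "m / (a + 3) \<le> (z + 4) / 5"
  proof -
    have "0 \<le> (6 - z) * (2 - a)" using a z by simp
    then show ?thesis using a unfolding m_def by (simp add: divide_simps) (simp add: algebra_simps)
  qed
  have r2: "m / (m + 7) \<le> (z + 4) / (z + 11)"
    using m5 a z unfolding m_def by (simp add: divide_simps) (simp add: algebra_simps)
  have "24 * m\<^sup>2 * z\<^sup>2 / ((a + 3) * (m + 7) * (z + 2) ^ 4)
      = 24 * (z\<^sup>2 / (z + 2) ^ 4) * (m / (a + 3) * (m / (m + 7)))"
    by (simp add: power2_eq_square mult_ac)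
  also have "\<dots> \<le> 24 * (z\<^sup>2 / (z + 2) ^ 4) * ((z + 4) / 5 * ((z + 4) / (z + 11)))"
    using r1 r2 m5 a z by (intro mult_left_mono mult_mono) auto
  also have "\<dots> = 24 * (z * (z + 4) / (z + 2)\<^sup>2)\<^sup>2 / (5 * (z + 11))"
    by (simp add: power2_eq_square power4_eq_xxxx mult_ac)
  also have "\<dots> \<le> 0.2751"
  proof -
    define w where "w = z + 2"
    have w: "2 \<le> w" "w \<le> 8" using z by (auto simp: w_def)
    have e: "z * (z + 4) / (z + 2)\<^sup>2 = 1 - 4 / w\<^sup>2"
      using w unfolding w_def by (simp add: divide_simps) (simp add: algebra_simps power2_eq_square)
    have "w\<^sup>2 \<le> 8\<^sup>2" "2\<^sup>2 \<le> w\<^sup>2" using w by (intro power_mono; simp)+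
    then have u: "0 \<le> 1 - 4 / w\<^sup>2" "1 - 4 / w\<^sup>2 \<le> 15 / 16" using w by (auto simp: divide_simps)
    have "(1 - 4 / w\<^sup>2)\<^sup>2 \<le> 15 / 16 * (1 - 4 / w\<^sup>2)"
      unfolding power2_eq_square[of "1 - 4 / w\<^sup>2"] using u by (intro mult_right_mono) auto
    also have "\<dots> \<le> 0.0573 * (w + 9)"
    proof -
      \<comment> \<open>expansion at \<open>5\<close>, close to the minimum of the cubic\<close>
      have "573 * w ^ 3 - 4218 * w\<^sup>2 + 37500
          = (573 * (w - 2) + 2658) * (w - 5)\<^sup>2 + 795 * (w - 2) + 1290"
        by (simp add: algebra_simps power2_eq_square power3_eq_cube)
      also have "\<dots> \<ge> 0" using w by (intro add_nonneg_nonneg mult_nonneg_nonneg) auto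
      finally show ?thesis
        using w by (simp add: divide_simps) (simp add: algebra_simps power2_eq_square power3_eq_cube)
    qed
    finally have "(1 - 4 / w\<^sup>2)\<^sup>2 \<le> 0.0573 * (z + 11)" by (simp add: w_def)
    then show ?thesis unfolding e using z by (simp add: divide_simps)
  qed
  finally have alg: "alg_part a z \<le> 1 / 6 + 1 / 12 + 1 / 10 + 1 / 60 + 0.2751"
    unfolding alg_part_def using b i bi by (simp add: m_def)
  have "exp_part a z X \<le> 36 / 10 * exp (- (2 + 0.44))"
  proof -
    define D where "D = 2 * a + 3"
    have D: "3 < D" "D < 7" "6 - z \<le> D - 2" using a m by (auto simp: D_def)
    let ?s = "3 / D - 1 / (D + 3)"
    have "z\<^sup>2 \<le> 6\<^sup>2 * exp (2 * ((z - 6) / 6))" using z by (intro sq_exp_le) auto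
    then have "z\<^sup>2 / 10 * exp ((6 - z) * ?s - 3)
        \<le> 6\<^sup>2 * exp (2 * ((z - 6) / 6)) / 10 * exp ((6 - z) * ?s - 3)"
      by (intro mult_right_mono divide_right_mono) auto
    also have "\<dots> = 36 / 10 * exp (2 * ((z - 6) / 6) + ((6 - z) * ?s - 3))"
      by (simp only: exp_add) simp
    also have "2 * ((z - 6) / 6) + ((6 - z) * ?s - 3) = (6 - z) * (?s - 1 / 3) - 3"
      by (simp add: field_simps)
    finally have 1: "z\<^sup>2 / 10 * exp ((6 - z) * ?s - 3) \<le> 36 / 10 * exp ((6 - z) * (?s - 1 / 3) - 3)" .
    have "(6 - z) * (?s - 1 / 3) \<le> 0.56"
    proof (cases "?s \<le> 1 / 3")
      case True
      then have "(6 - z) * (?s - 1 / 3) \<le> 0" using z by (intro mult_nonneg_nonpos) auto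
      then show ?thesis by (rule order_trans) simp
    next
      case False
      then have "(6 - z) * (?s - 1 / 3) \<le> (D - 2) * (?s - 1 / 3)"
        using D by (intro mult_right_mono) auto
      also have "\<dots> \<le> 0.56"
      proof -
        \<comment> \<open>\<open>3.65\<close> is close to the minimum of the cubic below, which is only about \<open>0.14\<close>\<close>
        define u where "u = D - 3.65"
        have "D ^ 3 - 3.32 * D\<^sup>2 - 15.96 * D + 54
            = (D - 3) * u\<^sup>2 + 6.7515 * u\<^sup>2 + 0.2285 * (u - 1 / 2)\<^sup>2 + 0.0853"
          by (simp add: u_def field_simps power2_eq_square power3_eq_cube)
        also have "\<dots> \<ge> 0" using D by (intro add_nonneg_nonneg mult_nonneg_nonneg) auto
        finally show ?thesis
          using D by (simp add: divide_simps) (simp add: algebra_simps power2_eq_square power3_eq_cube)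
      qed
      finally show ?thesis .
    qed
    moreover have "36 / 10 * exp (T - 3) \<le> 36 / 10 * exp (- (2 + 0.44))" if "T \<le> 0.56" for T :: real
      using that by simp
    ultimately have "z\<^sup>2 / 10 * exp ((6 - z) * ?s - 3) \<le> 36 / 10 * exp (- (2 + 0.44))"
      using 1 by (meson order_trans)
    moreover have "?s = 3 / (2 * a + 3) - 1 / (2 * a + 6)" by (simp add: D_def)
    ultimately show ?thesis using exp_part_le_low[OF a(1) z X] by simp
  qed
  moreover have "exp (- (real 2 + 0.44)) \<le> (0.0875 :: real)"
    by (rule exp_minus_le) (simp_all add: power2_eq_square power_divide)
  ultimately have "exp_part a z X \<le> 0.315" by simp
  with alg show ?thesis by simp
qed

text \<open>
  For \<open>a \<ge> 2\<close> the exponential part is at most \<open>z^2 / 10 * exp (- 1 - z / 3)\<close>, which increases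
  up to \<open>z = 6\<close>. For \<open>z \<le> 3\<close> it is small, and for \<open>z \<ge> 3\<close> the peak \<open>z^2 / (z + 2)^4\<close> has passed its
  maximum at \<open>z = 2\<close>.
\<close>

lemma sum_lt_large_a:
  fixes a z X :: real
  assumes a: "2 \<le> a" "a \<le> 17" and z: "0 < z" "z \<le> 6" and m: "5 \<le> z + 2 * a"
    and X: "X \<le> exp (- (3 * (z + 2 * a - 3) / (2 * a + 3)))"
  shows "alg_part a z + exp_part a z X < 0.966537"
proof -
  define m where "m = z + 2 * a"
  have m5: "5 \<le> m" "m \<le> 40" using m a z by (auto simp: m_def)
  define h where "h = (z / (z + 2)\<^sup>2)\<^sup>2"
  have alg: "alg_part a z \<le> 1 / 6 + (1.1 / m + 48 * h * (m / (m + 7)))"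
  proof -
    have b: "1 / (4 * (a + 3)) \<le> 1 / (2 * m)" using a z by (simp add: m_def divide_simps)
    have "5 * (2 * m) \<le> m * (4 * (a + 3))" by (rule mult_mono) (use a z m5 in \<open>auto simp: m_def\<close>)
    then have "1 / (4 * (a + 3) * m) \<le> 1 / (10 * m)" using a m5 by (simp add: divide_simps)
    moreover have "1 / (10 * m) + 1 / (2 * m) + 1 / (2 * m) = 1.1 / m" using m5 by (simp add: divide_simps)
    moreover have "24 * m\<^sup>2 * z\<^sup>2 / ((a + 3) * (m + 7) * (z + 2) ^ 4)
      \<le> 48 * h * (m / (m + 7))"
    proof -
      have "24 * m\<^sup>2 * z\<^sup>2 / ((a + 3) * (m + 7) * (z + 2) ^ 4) = m / (a + 3) * (24 * h * (m / (m + 7)))"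
        by (simp add: h_def power2_eq_square power4_eq_xxxx mult_ac)
      also have "\<dots> \<le> 2 * (24 * h * (m / (m + 7)))"
      proof (intro mult_right_mono)
        show "m / (a + 3) \<le> 2" using a z by (simp add: m_def divide_simps)
      qed (use m5 in \<open>auto simp: h_def\<close>)
      finally show ?thesis by simp
    qed
    ultimately show ?thesis using b unfolding alg_part_def by (simp flip: m_def)
  qed
  have tail: "exp_part a z X \<le> z\<^sup>2 / 10 * exp ((6 - z) / 3 - 3)"
  proof -
    have "3 / (2 * a + 3) - 1 / (2 * a + 6) = (4 * a + 15) / ((2 * a + 3) * (2 * a + 6))"
      using a by (simp add: divide_simps)
    also have "\<dots> \<le> 1 / 3"
    proof -
      have "2 * 2 \<le> a * a" using a by (intro mult_mono) auto
      then show ?thesis using a by (simp add: divide_simps) (simp add: algebra_simps)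
    qed
    finally have "(6 - z) * (3 / (2 * a + 3) - 1 / (2 * a + 6)) \<le> (6 - z) * (1 / 3)"
      using z by (intro mult_left_mono) auto
    then have "z\<^sup>2 / 10 * exp ((6 - z) * (3 / (2 * a + 3) - 1 / (2 * a + 6)) - 3)
        \<le> z\<^sup>2 / 10 * exp ((6 - z) / 3 - 3)" by (intro mult_left_mono) auto
    moreover have "0 < a" using a by simp
    ultimately show ?thesis using exp_part_le_low[OF _ z X] by linarith
  qed
  have tail_at: "exp_part a z X \<le> y\<^sup>2 / 10 * exp (2 * ((z - y) / y) + (6 - z) / 3 - 3)" if "0 < y" for y
  proof -
    have "z\<^sup>2 / 10 * exp ((6 - z) / 3 - 3) \<le> y\<^sup>2 * exp (2 * ((z - y) / y)) / 10 * exp ((6 - z) / 3 - 3)"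
      using sq_exp_le[OF z(1) that] by (intro mult_right_mono divide_right_mono) auto
    also have "\<dots> = y\<^sup>2 / 10 * exp (2 * ((z - y) / y) + (6 - z) / 3 - 3)"
      by (simp add: exp_add exp_diff)
    finally show ?thesis using tail by linarith
  qed
  show ?thesis
  proof (cases "z \<le> 3")
    case True
    have "z / (z + 2)\<^sup>2 \<le> 1 / 8"
    proof -
      have "(z + 2)\<^sup>2 - 8 * z = (z - 2)\<^sup>2" by (simp add: algebra_simps power2_eq_square)
      also have "\<dots> \<ge> 0" by simp
      finally show ?thesis using z by (simp add: divide_simps)
    qed
    then have "h \<le> (1 / 8)\<^sup>2" unfolding h_def using z by (intro power_mono) auto
    then have "48 * h * (m / (m + 7)) \<le> 0.75 * (m / (m + 7))"
      using m5 by (intro mult_right_mono) (auto simp: power2_eq_square)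
    with saturating_le[of 5 m 40 "0.75" "1.1"] m5 alg have A: "alg_part a z \<le> 0.8325" by simp
    have "exp_part a z X \<le> 3\<^sup>2 / 10 * exp (2 * ((z - 3) / 3) + (6 - z) / 3 - 3)" using tail_at[of 3] by simp
    also have "\<dots> \<le> 3\<^sup>2 / 10 * exp (- (real 2 + 0))"
      using True by (intro mult_left_mono) (auto simp: field_simps)
    also have "exp (- (real 2 + 0)) \<le> (0.136 :: real)"
      by (rule exp_minus_le) (simp_all add: power2_eq_square power_divide)
    finally show ?thesis using A by (simp add: power2_eq_square)
  next
    case False
    have "z / (z + 2)\<^sup>2 \<le> 3 / 25"
    proof -
      have "3 * (z + 2)\<^sup>2 - 25 * z = (z - 3) * (3 * z - 4)"
        by (simp add: algebra_simps power2_eq_square)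
      also have "\<dots> \<ge> 0" using False by simp
      finally show ?thesis using z by (simp add: divide_simps)
    qed
    then have "h \<le> (3 / 25)\<^sup>2" unfolding h_def using z by (intro power_mono) auto
    then have "48 * h * (m / (m + 7)) \<le> 0.6912 * (m / (m + 7))"
      using m5 by (intro mult_right_mono) (auto simp: power2_eq_square)
    with saturating_le[of 5 m 40 "0.6912" "1.1"] m5 alg have A: "alg_part a z \<le> 0.7826" by simp
    have "exp_part a z X \<le> 6\<^sup>2 / 10 * exp (2 * ((z - 6) / 6) + (6 - z) / 3 - 3)" using tail_at[of 6] by simp
    also have "2 * ((z - 6) / 6) + (6 - z) / 3 - 3 = - (real 3 + 0)" by (simp add: field_simps)
    also have "exp (- (real 3 + 0)) \<le> (0.0499 :: real)"
      by (rule exp_minus_le) (simp_all add: power2_eq_square power_divide)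
    finally show ?thesis using A by (simp add: power2_eq_square)
  qed
qed

section \<open>The bound for F\<close>

lemma sum_lt:
  fixes a z X :: real
  assumes a: "0 < a" "a \<le> 17" and z: "0 < z" and m: "5 \<le> z + 2 * a"
    and X: "X \<le> exp (- (3 * (z + 2 * a - 3) / (2 * a + 3)))"
    and X': "11 < a \<Longrightarrow> X \<le> exp (- (6 * (z + 2 * a - 3) / (3 * a + 17)))"
  shows "alg_part a z + exp_part a z X < 0.966537"
proof -
  consider "6 \<le> z" | "z \<le> 6" "a < 2" | "z \<le> 6" "2 \<le> a" by linarith
  then show ?thesis
    by cases (use assms sum_lt_z_ge_6 sum_lt_small_a sum_lt_large_a in blast)+
qed

text \<open>
  All terms of \<open>F\<close> are increasing in \<open>\<eta>\<close>, and \<open>\<eta>* \<le> \<alpha> / (\<alpha> + 3)\<close> amounts to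
  \<open>\<eta>* / \<alpha> \<le> 1 / (\<alpha> + 3)\<close> and \<open>1 - \<eta>* \<ge> 3 / (\<alpha> + 3)\<close>; the latter turns the first term into \<open>1 / 6\<close>.
  Only the power of \<open>\<eta>*\<close> itself is kept.
\<close>

lemma F_eta_star_le:
  fixes n :: int and a :: real
  assumes n: "6 \<le> n" and a: "0 < a" "a < (real_of_int n - 1) / 2"
  defines "z \<equiv> real_of_int n - 1 - 2 * a"
  shows "F (eta_star a) a n \<le> alg_part a z + exp_part a z (eta_star a powr ((real_of_int n - 4) / 2))"
proof -
  define m where "m = real_of_int n - 1"
  define e where "e = eta_star a"
  define c where "c = 1 - 2 * a / m"
  define k where "k = (m - 3) / 2"
  define S where "S = 6 * (k + 1) ^ 4 / ((1 + k * c) ^ 4 * ((k + 2) * (k + 3) * (k + 4) * (k + 5)))"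
  define C where "C = c\<^sup>2 * (m + 1) * m * (m - 1)"
  have m: "5 \<le> m" "2 * a < m" and z_eq: "z = m - 2 * a" and n_eq: "real_of_int n = m + 1"
    using n a by (auto simp: m_def z_def)
  have e: "0 < e" "e \<le> a / (a + 3)" using eta_star_bounds[OF a(1)] by (auto simp: e_def)
  have c: "0 < c" "c < 1" using m a by (auto simp: c_def field_simps)
  have C: "0 \<le> C" using m by (simp add: C_def)
  have ea: "e / (4 * a) \<le> 1 / (4 * (a + 3))" using e a by (simp add: field_simps)
  have "3 / (a + 3) \<le> 1 - e"
  proof -
    have "1 - a / (a + 3) = 3 / (a + 3)" using a by (simp add: field_simps)
    with e show ?thesis by linarith
  qed
  then have "e / (2 * a * (1 - e)) \<le> (a / (a + 3)) / (2 * a * (3 / (a + 3)))"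
    using e a by (intro frac_le mult_left_mono) (auto intro: mult_pos_pos)
  then have first: "e / (2 * a * (1 - e)) \<le> 1 / 6" using a by simp
  have fourth: "e / (4 * a * m) \<le> 1 / (4 * (a + 3) * m)"
    using divide_right_mono[OF ea, of m] m by simp
  have "integral {0..1} (\<lambda>t. t ^ 3 * beta e a n t powr k) \<le> S + e powr k / 5"
  proof -
    have "beta e a n t = (1 - t) * (1 - c * t) + e * t" for t
      unfolding beta_def c_def m_def[symmetric]
      by (simp add: algebra_simps power2_eq_square diff_divide_distrib)
    then show ?thesis
      using integral_cube_quadratic_powr_le[OF c e(1), of k] m by (simp add: S_def k_def)
  qed
  then have "C * (e / (4 * a)) * integral {0..1} (\<lambda>t. t ^ 3 * beta e a n t powr k)
      \<le> C * (e / (4 * a)) * (S + e powr k / 5)"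
    using C e a by (intro mult_left_mono) auto
  also have "\<dots> \<le> C * (1 / (4 * (a + 3))) * (S + e powr k / 5)"
  proof -
    have "0 \<le> S" unfolding S_def k_def using m c by simp
    then show ?thesis using C ea by (intro mult_right_mono mult_left_mono) auto
  qed
  also have "\<dots> = C * S / (4 * (a + 3)) + C * e powr k / (20 * (a + 3))"
    by (simp add: distrib_left)
  also have "\<dots> \<le> 24 * m\<^sup>2 * z\<^sup>2 / ((a + 3) * (m + 7) * (z + 2) ^ 4) + exp_part a z (e powr k)"
  proof (rule add_mono)
    have "C * S \<le> 96 * m\<^sup>2 * z\<^sup>2 / ((m + 7) * (z + 2) ^ 4)"
      using rational_part_le[of a m] m a unfolding C_def S_def k_def c_def z_eq by simp
    then have "C * S / (4 * (a + 3)) \<le> 96 * m\<^sup>2 * z\<^sup>2 / ((m + 7) * (z + 2) ^ 4) / (4 * (a + 3))"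
      using a by (intro divide_right_mono) auto
    also have "\<dots> = 24 * m\<^sup>2 * z\<^sup>2 / ((a + 3) * (m + 7) * (z + 2) ^ 4)"
      by (simp add: mult_ac del: distrib_left_numeral distrib_right_numeral)
    finally show "C * S / (4 * (a + 3)) \<le> \<dots>" .
    have "z = c * m" using m by (simp add: c_def z_eq field_simps)
    then have "C * m = z\<^sup>2 * (m\<^sup>2 - 1)"
      by (simp add: C_def power2_eq_square algebra_simps)
    then have "C = z\<^sup>2 * (m\<^sup>2 - 1) / m" using m by (simp add: eq_divide_eq)
    also have "\<dots> \<le> z\<^sup>2 * m\<^sup>2 / m" using m by (intro divide_right_mono mult_left_mono) auto
    also have "\<dots> = m * z\<^sup>2" using m by (simp add: power2_eq_square)
    finally have "C * e powr k / (20 * (a + 3)) \<le> m * z\<^sup>2 * e powr k / (20 * (a + 3))"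
      using a by (intro divide_right_mono mult_right_mono) auto
    then show "C * e powr k / (20 * (a + 3)) \<le> exp_part a z (e powr k)"
      by (simp add: exp_part_def z_eq)
  qed
  finally have last: "C * (e / (4 * a)) * integral {0..1} (\<lambda>t. t ^ 3 * beta e a n t powr k) \<le> \<dots>" .
  have k_eq: "(real_of_int n - 4) / 2 = k" by (simp add: k_def m_def)
  have "F e a n = e / (2 * a * (1 - e)) + e / (4 * a) + 1 / (2 * m) + e / (4 * a * m)
      + C * (e / (4 * a)) * integral {0..1} (\<lambda>t. t ^ 3 * beta e a n t powr k)"
    unfolding F_def k_eq by (simp add: n_eq C_def c_def mult_ac)
  also have "\<dots> \<le> alg_part a z + exp_part a z (e powr k)"
  proof -
    have "z + 2 * a = m" by (simp add: z_eq)
    then show ?thesis using first ea fourth last unfolding alg_part_def by (simp only:)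
  qed
  finally show ?thesis unfolding k_eq by (simp add: e_def)
qed

theorem mainTheorem2:
  fixes n :: int and \<alpha> :: real
  assumes "n \<ge> 6" and "0 < \<alpha>" and "\<alpha> \<le> 17" and "\<alpha> < (real_of_int n - 1) / 2"
  shows "F (eta_star \<alpha>) \<alpha> n < 0.966537 \<and> (0.966537 :: real) < 97 / 100 \<and> (97 / 100 :: real) < 1"
proof -
  define z where "z = real_of_int n - 1 - 2 * \<alpha>"
  define X where "X = eta_star \<alpha> powr ((real_of_int n - 4) / 2)"
  have m: "z + 2 * \<alpha> = real_of_int n - 1" by (simp add: z_def)
  have n5: "5 \<le> real_of_int n - 1" using assms(1) by simp
  have k: "(real_of_int n - 4) / 2 = ((real_of_int n - 1) - 3) / 2" by simp
  have "alg_part \<alpha> z + exp_part \<alpha> z X < 0.966537"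
    using eta_star_powr_le[OF assms(2), of "real_of_int n - 1"] n5 assms
    unfolding X_def k by (intro sum_lt; (unfold m)?) (auto simp: z_def)
  with F_eta_star_le[OF assms(1,2,4)] have "F (eta_star \<alpha>) \<alpha> n < 0.966537"
    by (simp add: z_def X_def)
  then show ?thesis by simp
qed

end
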